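(* Let $n$ be an even positive integer. For $i\in\{0,1\}$ let $E_i=\{j\in[0,n]:j\equiv i\pmod 2\}$. Then $\overline{L}_{n,n/2-1}(E_0)=\overline{L}_{n,n/2-1}(E_1)=[0,n]$.
   Context: For integers $a\le b$, $[a,b]$ denotes the set of integers $t$ with $a\le t\le b$. For $d\in[0,n]$ and $E=\{t_1<\cdots<t_s\}\subseteq[0,n]$, define $L_{n,d}(E)=E$ if $|E|\le d$, and $L_{n,d}(E)=[0,t_{s-d}]\cup E\cup[t_{d+1},n]$ if $|E|\ge d+1$. With $L_{n,d}^0=\mathrm{id}$ and $L_{n,d}^{k+1}=L_{n,d}\circ L_{n,d}^k$, define $\overline{L}_{n,d}(E)=\bigcup_{k\ge0}L_{n,d}^k(E)$. *)

theory Defs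
  imports Main "HOL-Number_Theory.Cong"
begin

text \<open>The integer interval \<open>[a,b]\<close> with \<open>0 \<le> a\<close> is rendered as the set \<open>{a..b}\<close> of
  natural numbers. For a finite set \<open>E = {t\<^sub>1 < \<dots> < t\<^sub>s}\<close>, the element \<open>t\<^sub>i\<close> (indexed from 1,
  meaningful for \<open>1 \<le> i \<le> s\<close>) is \<open>elt E i\<close>.\<close>

definition elt :: "nat set \<Rightarrow> nat \<Rightarrow> nat" where
  "elt E i = sorted_list_of_set E ! (i - 1)"

text \<open>\<open>L n d\<close> and \<open>Lbar n d\<close> are intended for \<open>d \<le> n\<close> and \<open>E \<subseteq> {0..n}\<close>.\<close>

definition L :: "nat \<Rightarrow> nat \<Rightarrow> nat set \<Rightarrow> nat set" where
  "L n d E =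
    (if card E \<le> d then E
     else {0..elt E (card E - d)} \<union> E \<union> {elt E (d + 1)..n})"

definition Lbar :: "nat \<Rightarrow> nat \<Rightarrow> nat set \<Rightarrow> nat set" where
  "Lbar n d E = (\<Union>k. (L n d ^^ k) E)"

definition parity_class :: "nat \<Rightarrow> nat \<Rightarrow> nat set" where
  "parity_class n i = {j \<in> {0..n}. [j = i] (mod 2)}"

end

theory Submission
  imports Defs
begin

text \<open>The \<open>c\<close>-th stage \<open>stage n c\<close> consists of the first and the last \<open>c\<close> points of \<open>[0,n]\<close>
  together with every second point in between. While \<open>c \<le> n/2\<close> it has \<open>n/2 + c\<close> elements, so with
  \<open>d = n/2 - 1\<close> the operator looks at the \<open>(c+1)\<close>-st element from either end; these are \<open>c + 1\<close> and
  \<open>n - c - 1\<close>, since \<open>c\<close> and \<open>n - c\<close> are the first points missing. Hence each application of the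
  operator turns stage \<open>c\<close> into stage \<open>c + 2\<close>, and the stages with \<open>c > n/2\<close> are all of \<open>[0,n]\<close>.
  The parity classes of 0 and 1 are the stages 1 and 0.\<close>

lemma elt_in:
  assumes "finite E" "0 < i" "i \<le> card E"
  shows "elt E i \<in> E"
proof -
  have "i - 1 < length (sorted_list_of_set E)"
    using assms by simp
  then show ?thesis
    unfolding elt_def using nth_mem[of "i - 1" "sorted_list_of_set E"] assms(1) by simp
qed

text \<open>\<open>elt\<close> counts from 1, so an element with \<open>k\<close> smaller ones has
  position \<open>Suc k\<close>. Positions are thus found by counting.\<close>

lemma elt_eqI:
  assumes "finite E" "x \<in> E" "card {y \<in> E. y < x} = k"
  shows "elt E (Suc k) = x"
proof -
  let ?l = "sorted_list_of_set E"
  have sl: "sorted_wrt (<) ?l"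
    by (rule strict_sorted_list_of_set)
  obtain j where j: "j < length ?l" "?l ! j = x"
    using assms(1,2) by (metis in_set_conv_nth set_sorted_list_of_set)
  have less_iff: "?l ! i < ?l ! j \<longleftrightarrow> i < j" if "i < length ?l" for i
    using sorted_wrt_nth_less[OF sl] that j(1)
    by (metis less_asym less_irrefl linorder_neqE_nat)
  \<comment> \<open>Strict sorting makes the order of values agree with the order of indices, so
    exactly \<open>j\<close> elements lie below \<open>x\<close>.\<close>
  have "{y \<in> E. y < x} = (!) ?l ` {..<j}"
  proof (intro equalityI subsetI)
    fix y assume "y \<in> {y \<in> E. y < x}"
    then obtain i where "i < length ?l" "?l ! i = y" "y < x"
      using assms(1) by (metis (lifting) in_set_conv_nth mem_Collect_eq set_sorted_list_of_set)
    then show "y \<in> (!) ?l ` {..<j}"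
      using less_iff j(2) by auto
  next
    fix y assume "y \<in> (!) ?l ` {..<j}"
    then obtain i where i: "i < j" "y = ?l ! i" by auto
    then have l: "i < length ?l" using j(1) by simp
    then have "?l ! i \<in> E"
      using nth_mem[OF l] assms(1) by simp
    then show "y \<in> {y \<in> E. y < x}"
      using i less_iff[OF l] j(2) by simp
  qed
  moreover have "inj_on ((!) ?l) {..<j}"
    using j(1) by (auto intro: inj_on_nth)
  ultimately have "k = j"
    using assms(3) by (simp add: card_image)
  then show ?thesis
    using j(2) by (simp add: elt_def)
qed

text \<open>With \<open>subset_L\<close> this makes \<open>{0..n}\<close> a fixed point. Only the
  left interval needs a bound, and its upper end is an element of \<open>E\<close>.\<close>

lemma L_subset:
  assumes "E \<subseteq> {0..n}"
  shows "L n d E \<subseteq> {0..n}"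
proof (cases "card E \<le> d")
  case False
  have "finite E"
    using assms finite_subset by blast
  then have "elt E (card E - d) \<in> E"
    using False by (intro elt_in) auto
  then have "elt E (card E - d) \<le> n"
    using assms by auto
  then show ?thesis
    using assms by (auto simp: L_def)
qed (use assms in \<open>simp add: L_def\<close>)

lemma subset_L: "E \<subseteq> L n d E"
  by (auto simp: L_def)

definition stage :: "nat \<Rightarrow> nat \<Rightarrow> nat set" where
  "stage n c = {x. x \<le> n \<and> (x < c \<or> n < x + c \<or> odd (x + c))}"

lemma finite_stage: "finite (stage n c)"
  by (rule finite_subset[of _ "{..n}"]) (auto simp: stage_def)

lemma stage_eq_atLeastAtMost: "n < 2 * c \<Longrightarrow> stage n c = {0..n}"
  by (auto simp: stage_def)

lemma card_stage:
  assumes "c \<le> m"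
  shows "card (stage (2 * m) c) = m + c"
proof -
  \<comment> \<open>\<open>?M\<close> is the middle part, strictly between the two end blocks of
    \<open>c\<close> points each.\<close>
  let ?M = "(\<lambda>j. c + 1 + 2 * j) ` {..<m - c}"
  have "stage (2 * m) c = {..<c} \<union> ({2 * m - c<..2 * m} \<union> ?M)"
  proof (intro equalityI subsetI)
    fix x assume x: "x \<in> stage (2 * m) c"
    show "x \<in> {..<c} \<union> ({2 * m - c<..2 * m} \<union> ?M)"
    proof (cases "x < c \<or> 2 * m < x + c")
      case False
      then have "odd (x + c)" "c \<le> x" "x + c \<le> 2 * m"
        using x by (auto simp: stage_def)
      moreover from this obtain j where "x = c + 1 + 2 * j"
        by (metis add.assoc add.commute even_add le_Suc_ex oddE)
      ultimately show ?thesis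
        by auto
    qed (use x assms in \<open>auto simp: stage_def\<close>)
  qed (use assms in \<open>auto simp: stage_def\<close>)
  also have "card \<dots> = c + (c + (m - c))"
  proof -
    have "card ?M = m - c"
      by (subst card_image) (auto simp: inj_on_def)
    moreover have "card ({2 * m - c<..2 * m} \<union> ?M) = card {2 * m - c<..2 * m} + card ?M"
      by (rule card_Un_disjoint) auto
    moreover have "card ({..<c} \<union> ({2 * m - c<..2 * m} \<union> ?M))
        = card {..<c} + card ({2 * m - c<..2 * m} \<union> ?M)"
      using assms by (intro card_Un_disjoint) auto
    ultimately show ?thesis
      using assms by simp
  qed
  finally show ?thesis
    using assms by simp
qed

lemma L_stage:
  assumes "0 < m"
  shows "L (2 * m) (m - 1) (stage (2 * m) c) = stage (2 * m) (c + 2)"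
proof (cases "c \<le> m")
  case False
  then have "stage (2 * m) c = {0..2 * m}" "stage (2 * m) (c + 2) = {0..2 * m}"
    by (auto intro!: stage_eq_atLeastAtMost)
  then show ?thesis
    using L_subset[of "{0..2 * m}"] subset_L[of "{0..2 * m}"] by (simp add: equalityI)
next
  case True
  let ?F = "stage (2 * m) c"
  have card_F: "card ?F = m + c"
    using True by (rule card_stage)
  have "elt ?F (Suc c) = c + 1"
  proof (rule elt_eqI[OF finite_stage])
    show "c + 1 \<in> ?F"
      using True assms by (auto simp: stage_def)
    \<comment> \<open>The point \<open>c\<close> is missing because \<open>c + c\<close> is even and
      \<open>c\<close> lies in neither end block.\<close>
    have "{y \<in> ?F. y < c + 1} = {..<c}"
      using True by (auto simp: stage_def less_Suc_eq)
    then show "card {y \<in> ?F. y < c + 1} = c"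
      by simp
  qed
  moreover have "elt ?F (Suc (m - 1)) = 2 * m - c - 1"
  proof (rule elt_eqI[OF finite_stage])
    let ?x = "2 * m - c - 1"
    show "?x \<in> ?F"
      using True assms by (auto simp: stage_def)
    \<comment> \<open>The rank from below is obtained by counting from above: \<open>Suc c\<close>
      of the \<open>m + c\<close> elements are at least \<open>?x\<close>, which leaves
      \<open>m - 1\<close> below it.\<close>
    have "{y \<in> ?F. \<not> y < ?x} = insert ?x {2 * m - c<..2 * m}"
    proof (intro equalityI subsetI)
      fix y assume y: "y \<in> {y \<in> ?F. \<not> y < ?x}"
      have "y \<noteq> 2 * m - c"
        using y True by (auto simp: stage_def)
      then show "y \<in> insert ?x {2 * m - c<..2 * m}"
        using y by (auto simp: stage_def)
    qed (use True assms in \<open>auto simp: stage_def\<close>)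
    then have "card {y \<in> ?F. \<not> y < ?x} = Suc c"
      using True by simp
    moreover have "card ?F = card {y \<in> ?F. y < ?x} + card {y \<in> ?F. \<not> y < ?x}"
      by (subst card_Un_disjoint[symmetric])
        (auto simp: finite_stage intro!: arg_cong[where f = card])
    ultimately show "card {y \<in> ?F. y < ?x} = m - 1"
      using card_F by simp
  qed
  moreover have "card ?F - (m - 1) = Suc c"
    using card_F assms by simp
  ultimately have "L (2 * m) (m - 1) ?F = {0..c + 1} \<union> ?F \<union> {2 * m - c - 1..2 * m}"
    using card_F assms by (simp add: L_def)
  \<comment> \<open>Each end block grows by two points, and \<open>c + 2\<close> has the parity of
    \<open>c\<close>, so the middle condition is unchanged.\<close>
  also have "\<dots> = stage (2 * m) (c + 2)"
    using True assms by (auto simp: stage_def)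
  finally show ?thesis .
qed

lemma Lbar_stage:
  assumes "0 < m"
  shows "Lbar (2 * m) (m - 1) (stage (2 * m) c) = {0..2 * m}"
proof -
  have iterate: "(L (2 * m) (m - 1) ^^ k) (stage (2 * m) c) = stage (2 * m) (c + 2 * k)" for k
    by (induction k) (simp_all add: L_stage[OF assms, simplified])
  \<comment> \<open>After \<open>Suc m\<close> iterations the parameter exceeds \<open>m\<close>,
    whatever \<open>c\<close> is.\<close>
  have "stage (2 * m) (c + 2 * Suc m) = {0..2 * m}"
    by (rule stage_eq_atLeastAtMost) simp
  moreover have "stage (2 * m) k \<subseteq> {0..2 * m}" for k
    by (auto simp: stage_def)
  ultimately show ?thesis
    unfolding Lbar_def iterate by blast
qed

theorem proposition1p15:
  fixes n :: nat
  assumes "even n" and "n > 0"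
  shows "Lbar n (n div 2 - 1) (parity_class n 0) = {0..n} \<and>
         Lbar n (n div 2 - 1) (parity_class n 1) = {0..n}"
proof -
  obtain m where m: "n = 2 * m" "0 < m"
    using assms by (auto elim: evenE)
  have "parity_class n 0 = stage n 1"
  proof -
    \<comment> \<open>The last block of \<open>stage n 1\<close> is the single point
      \<open>n\<close>, which is even by assumption.\<close>
    have "even x" if "x \<le> n" "n < x + 1" for x
      using that assms(1) by (metis Suc_eq_plus1 le_antisym less_Suc_eq_le)
    then show ?thesis
      by (auto simp: parity_class_def stage_def cong_0_iff)
  qed
  moreover have "parity_class n 1 = stage n 0"
    by (auto simp: parity_class_def stage_def cong_def odd_iff_mod_2_eq_one)
  ultimately show ?thesis
    using Lbar_stage[OF m(2)] m(1) by simp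
qed

end
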